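(* Let $f\colon\mathbb{R}^n\to[-\infty,+\infty]$ be a proper nearly convex function, $\Omega_0\subset\mathbb{R}^n$ a nonempty nearly convex set, and $g_1,\dots,g_m\colon\mathbb{R}^n\to[-\infty,+\infty]$ proper nearly convex functions. Let $\Omega_1=\{x\in\mathbb{R}^n\mid g_i(x)\le0,\ i=1,\dots,m\}$ and $D=\Omega_0\cap\Omega_1$. Assume that there is a point $x^0\in(\mathrm{ri}\,\Omega_0)\cap\bigl(\bigcap_{i=1}^m\mathrm{ri}(\mathrm{dom}\,g_i)\bigr)$ with $g_i(x^0)<0$ for all $i=1,\dots,m$ and with $x^0\in\mathrm{ri}(\mathrm{dom}\,f)$. Let $\bar x\in D\cap(\mathrm{dom}\,f)$ be a point at which the functions $\bar g_1,\dots,\bar g_m$ are continuous and such that $\bar f(\bar x)=f(\bar x)$ and $\bar g_i(\bar x)=g_i(\bar x)$ for all $i=1,\dots,m$. If $\bar x$ is a solution of the problem $\min\{f(x)\mid x\in D\}$, then there exist Lagrange multipliers $\lambda_1\ge0,\dots,\lambda_m\ge0$ such that $$0\in\partial f(\bar x)+\sum_{i=1}^m\lambda_i\,\partial g_i(\bar x)+N(\bar x;\Omega_0)$$ and $\lambda_ig_i(\bar x)=0$ for $i=1,\dots,m$. Conversely, if $\bar x\in\mathrm{ri}(\mathrm{dom}\,f)$ and there exist $\lambda_1\ge0,\dots,\lambda_m\ge0$ satisfying these conditions, then $\bar x$ is a solution of the problem $\min\{f(x)\mid x\in D\}$.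
   Context: A set $\Omega\subset\mathbb{R}^n$ is nearly convex if there is a convex set $C\subset\mathbb{R}^n$ with $C\subset\Omega\subset\bar C$, where the bar on a set denotes topological closure. For an arbitrary set $\Omega$, $\mathrm{ri}\,\Omega$ is the interior of $\Omega$ relative to its affine hull. For $h\colon\mathbb{R}^n\to[-\infty,+\infty]$: $\mathrm{dom}\,h=\{x\mid h(x)<+\infty\}$, $\mathrm{epi}\,h=\{(x,\lambda)\in\mathbb{R}^n\times\mathbb{R}\mid h(x)\le\lambda\}$; $h$ is proper if $\mathrm{dom}\,h\ne\emptyset$ and $h(x)>-\infty$ for all $x$; $h$ is nearly convex if $\mathrm{epi}\,h$ is a nearly convex set. For any function $h$, $\bar h(x)=\inf\{\alpha\in\mathbb{R}\mid (x,\alpha)\in\overline{\mathrm{epi}\,h}\}$, with $\inf\emptyset=+\infty$. $h$ is continuous at $\bar x$ if $\bar x\in\mathrm{int}(\mathrm{dom}\,h)$ and for every $\varepsilon>0$ there is $\delta>0$ such that the open ball $B(\bar x,\delta)\subset\mathrm{dom}\,h$ and $|h(x)-h(\bar x)|<\varepsilon$ for all $x\in B(\bar x,\delta)$. If $h(\bar x)\in\mathbb{R}$, $\partial h(\bar x)=\{x^*\in\mathbb{R}^n\mid\langle x^*,x-\bar x\rangle\le h(x)-h(\bar x)\ \text{for all }x\in\mathbb{R}^n\}$. The normal cone to a nearly convex set $\Omega$ at $\bar x\in\Omega$ is $N(\bar x;\Omega)=\{x^*\in\mathbb{R}^n\mid\langle x^*,x-\bar x\rangle\le0\ \text{for all }x\in\Omega\}$.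 A solution of a problem $\min\{h(x)\mid x\in E\}$ is a point $\bar x\in E$ with $h(\bar x)\le h(x)$ for all $x\in E$. *)

theory Defs
  imports "HOL-Analysis.Analysis"
begin

definition nearly_convex :: "'a::euclidean_space set \<Rightarrow> bool" where
  "nearly_convex S \<longleftrightarrow> (\<exists>C. convex C \<and> C \<subseteq> S \<and> S \<subseteq> closure C)"

definition eff_dom :: "('a::euclidean_space \<Rightarrow> ereal) \<Rightarrow> 'a set" where
  "eff_dom h = {x. h x < \<infinity>}"

(* The library's epigraph is for real-valued functions on a set; here the function is
   extended-real-valued, while the second component is still a real number. *)
definition epi :: "('a::euclidean_space \<Rightarrow> ereal) \<Rightarrow> ('a \<times> real) set" where
  "epi h = {(x, r). h x \<le> ereal r}"

definition proper_fun :: "('a::euclidean_space \<Rightarrow> ereal) \<Rightarrow> bool" where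
  "proper_fun h \<longleftrightarrow> eff_dom h \<noteq> {} \<and> (\<forall>x. - \<infinity> < h x)"

definition nearly_convex_fun :: "('a::euclidean_space \<Rightarrow> ereal) \<Rightarrow> bool" where
  "nearly_convex_fun h \<longleftrightarrow> nearly_convex (epi h)"

(* The infimum is taken in ereal, so it is \<infinity> over the empty set. *)
definition closure_fun :: "('a::euclidean_space \<Rightarrow> ereal) \<Rightarrow> 'a \<Rightarrow> ereal" where
  "closure_fun h x = (INF r \<in> {r. (x, r) \<in> closure (epi h)}. ereal r)"

(* In ereal, -\<infinity> - (-\<infinity>) = \<infinity>, so the inequality fails at points where h is infinite:
   continuity forces h to be finite on the ball. *)
definition continuous_at_pt :: "('a::euclidean_space \<Rightarrow> ereal) \<Rightarrow> 'a \<Rightarrow> bool" where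
  "continuous_at_pt h x \<longleftrightarrow>
     x \<in> interior (eff_dom h) \<and>
     (\<forall>\<epsilon>::real. \<epsilon> > 0 \<longrightarrow>
        (\<exists>\<delta>>0. ball x \<delta> \<subseteq> eff_dom h \<and> (\<forall>y\<in>ball x \<delta>. \<bar>h y - h x\<bar> < ereal \<epsilon>)))"

(* The subdifferential is defined at points where h is finite; elsewhere it is empty
   by convention. *)
definition subdifferential :: "('a::euclidean_space \<Rightarrow> ereal) \<Rightarrow> 'a \<Rightarrow> 'a set" where
  "subdifferential h x =
     (if \<bar>h x\<bar> \<noteq> \<infinity> then {v. \<forall>y. ereal (v \<bullet> (y - x)) \<le> h y - h x} else {})"

definition normal_cone :: "'a::euclidean_space \<Rightarrow> 'a set \<Rightarrow> 'a set" where
  "normal_cone x S = {v. \<forall>y\<in>S. v \<bullet> (y - x) \<le> 0}"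

definition is_solution :: "('a::euclidean_space \<Rightarrow> ereal) \<Rightarrow> 'a set \<Rightarrow> 'a \<Rightarrow> bool" where
  "is_solution h E x \<longleftrightarrow> x \<in> E \<and> (\<forall>y\<in>E. h x \<le> h y)"

(* Sums of sets are Minkowski sums (Set_Algebras), and t *\<^sub>R S is the pointwise image,
   so that 0 times the empty set is empty. *)
definition lagrange_conditions ::
  "('a::euclidean_space \<Rightarrow> ereal) \<Rightarrow> 'a set \<Rightarrow> nat \<Rightarrow> (nat \<Rightarrow> 'a \<Rightarrow> ereal) \<Rightarrow> 'a \<Rightarrow> (nat \<Rightarrow> real) \<Rightarrow> bool"
  where
  "lagrange_conditions f \<Omega>\<^sub>0 m g x lam \<longleftrightarrow>
     0 \<in> subdifferential f x
          + (\<Sum>i=1..m. (\<lambda>v. lam i *\<^sub>R v) ` subdifferential (g i) x)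
          + normal_cone x \<Omega>\<^sub>0 \<and>
     (\<forall>i\<in>{1..m}. ereal (lam i) * g i x = 0)"

end

(* On the relative interior of its effective domain a proper nearly convex function coincides
   with its closure, so it is an ordinary real-valued convex function there, and adding the point
   xbar to that relative interior preserves convexity.  The problem thus reduces to real-valued
   convex functions on convex sets; subgradient inequalities return to the original functions
   because epi h lies in the closure of rel_interior (epi h).
   In the convex problem the constraints are absorbed into the objective one at a time: an
   elementary Slater argument produces each multiplier, and a sum rule, obtained from a supporting
   hyperplane at a relative boundary point, splits the resulting subgradient.  Continuity of the
   closures of the g i puts xbar in the interior of their domains, which yields subgradients even
   for vanishing multipliers, as 0 times the empty set is empty. *)
theory Submission
  imports Defs
begin

subsection \<open>Convex functions with real values\<close>

text \<open>These are the ordinary subgradients of \<phi> extended by infinity outside S. For \<phi>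
  = 0 and x in S they are the normal vectors to S at x.\<close>

definition subgradient_on :: "'a::euclidean_space set \<Rightarrow> ('a \<Rightarrow> real) \<Rightarrow> 'a \<Rightarrow> 'a \<Rightarrow> bool" where
  "subgradient_on S \<phi> x v \<longleftrightarrow> (\<forall>y\<in>S. \<phi> x + v \<bullet> (y - x) \<le> \<phi> y)"

section \<open>One multiplier from Slater's condition\<close>

text \<open>Each point y with \<open>\<gamma> y > 0\<close> demands
  \<open>l \<ge> (\<phi> x - \<phi> y) / \<gamma> y\<close>, and each z with
  \<open>\<gamma> z < 0\<close> demands
  \<open>l \<le> (\<phi> z - \<phi> x) / (- \<gamma> z)\<close>. Convexity makes every lower bound
  at most every upper bound, and x0 supplies an upper bound, so the supremum of the lower bounds
  serves as l.\<close>

lemma slater_multiplier: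
  fixes \<phi> \<gamma> :: "'a::real_vector \<Rightarrow> real"
  assumes "convex_on T \<phi>" "convex_on T \<gamma>"
    and "x \<in> T" "\<gamma> x \<le> 0" "x0 \<in> T" "\<gamma> x0 < 0"
    and min: "\<And>y. y \<in> T \<Longrightarrow> \<gamma> y \<le> 0 \<Longrightarrow> \<phi> x \<le> \<phi> y"
  obtains l where "l \<ge> 0" "l * \<gamma> x = 0" "\<And>y. y \<in> T \<Longrightarrow> \<phi> x \<le> \<phi> y + l * \<gamma> y"
proof -
  \<comment> \<open>Inserting 0 makes the supremum nonnegative and keeps Q nonempty when no point
    violates the constraint.\<close>
  define Q where "Q = insert 0 ((\<lambda>y. (\<phi> x - \<phi> y) / \<gamma> y) ` {y \<in> T. \<gamma> y > 0})"
  have bound: "q \<le> (\<phi> z - \<phi> x) / (- \<gamma> z)" if "q \<in> Q" and z: "z \<in> T" "\<gamma> z < 0" for q z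
  proof (cases "q = 0")
    case True
    then show ?thesis using min[OF z(1)] z(2) by (auto simp: field_simps)
  next
    case False
    then obtain y where y: "y \<in> T" "\<gamma> y > 0" and q: "q = (\<phi> x - \<phi> y) / \<gamma> y"
      using \<open>q \<in> Q\<close> by (auto simp: Q_def)
    \<comment> \<open>At this t the chord of \<gamma> from y to z crosses zero, so the point
      \<open>?u\<close> is feasible and can be compared with x.\<close>
    define t where "t = \<gamma> y / (\<gamma> y - \<gamma> z)"
    have t: "0 \<le> t" "t \<le> 1" and t1: "1 - t = - \<gamma> z / (\<gamma> y - \<gamma> z)"
      using y z by (auto simp: t_def field_simps)
    let ?u = "(1 - t) *\<^sub>R y + t *\<^sub>R z"
    have "convex T" using assms(1) by (simp add: convex_on_imp_convex)
    then have uT: "?u \<in> T" using t y(1) z(1) by (simp add: convexD)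
    have "\<gamma> ?u \<le> (1 - t) * \<gamma> y + t * \<gamma> z"
      using convex_onD[OF assms(2) t y(1) z(1)] .
    also have "\<dots> = 0" unfolding t1 unfolding t_def using y z by (simp add: field_simps)
    finally have "\<phi> x \<le> \<phi> ?u" using min[OF uT] by simp
    also have "\<dots> \<le> (1 - t) * \<phi> y + t * \<phi> z"
      using convex_onD[OF assms(1) t y(1) z(1)] .
    also have "\<dots> = (- \<gamma> z * \<phi> y + \<gamma> y * \<phi> z) / (\<gamma> y - \<gamma> z)"
      unfolding t1 unfolding t_def by (simp add: add_divide_distrib diff_divide_distrib)
    finally have "\<phi> x * (\<gamma> y - \<gamma> z) \<le> - \<gamma> z * \<phi> y + \<gamma> y * \<phi> z"
      using y z by (simp add: pos_le_divide_eq)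
    then have "(\<phi> x - \<phi> y) * (- \<gamma> z) \<le> (\<phi> z - \<phi> x) * \<gamma> y"
      by (simp add: algebra_simps)
    then show ?thesis unfolding q using y z
      by (subst pos_divide_le_eq, simp, subst times_divide_eq_left, subst pos_le_divide_eq) auto
  qed
  have bdd: "bdd_above Q" using bound[OF _ assms(5,6)] by (meson bdd_aboveI)
  define l where "l = Sup Q"
  have l0: "l \<ge> 0" unfolding l_def by (rule cSup_upper[OF _ bdd]) (simp add: Q_def)
  have key: "\<phi> x \<le> \<phi> y + l * \<gamma> y" if y: "y \<in> T" for y
  proof (cases "\<gamma> y" "0::real" rule: linorder_cases)
    case less
    have "l \<le> (\<phi> y - \<phi> x) / (- \<gamma> y)"
      unfolding l_def by (rule cSup_least) (use bound[OF _ y less] in \<open>auto simp: Q_def\<close>)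
    then show ?thesis using less by (simp add: field_simps)
  next
    case equal
    then show ?thesis using min[OF y] by simp
  next
    case greater
    have "(\<phi> x - \<phi> y) / \<gamma> y \<le> l"
      unfolding l_def by (rule cSup_upper[OF _ bdd]) (use y greater in \<open>auto simp: Q_def\<close>)
    then show ?thesis using greater by (simp add: field_simps)
  qed
  \<comment> \<open>\<open>key\<close> at y = x gives \<open>0 \<le> l * \<gamma> x\<close>; the
    signs of l and \<open>\<gamma> x\<close> give the reverse.\<close>
  have "l * \<gamma> x = 0"
    using key[OF assms(3)] mult_nonneg_nonpos[OF l0 assms(4)] by simp
  with l0 key show ?thesis using that by blast
qed

section \<open>The sum rule and subgradients at interior points\<close>

text \<open>The segment from y to x can be prolonged beyond x inside S. If the linear functional
  were larger at y than at x, it would fall below its minimum on the prolongation.\<close>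

lemma inner_const_of_min_rel_interior:
  fixes S :: "'a::euclidean_space set"
  assumes S: "convex S" and x: "x \<in> rel_interior S" and y: "y \<in> S"
    and min: "\<And>z. z \<in> S \<Longrightarrow> a \<bullet> x \<le> a \<bullet> z"
  shows "a \<bullet> y = a \<bullet> x"
proof -
  have "S \<noteq> {}" using y by blast
  then obtain e where e: "e > 1" "(1 - e) *\<^sub>R y + e *\<^sub>R x \<in> S"
    using convex_rel_interior_iff[OF S, of x] x y by blast
  have "a \<bullet> x \<le> (1 - e) * (a \<bullet> y) + e * (a \<bullet> x)"
    using min[OF e(2)] by (simp add: inner_add_right)
  then have "(e - 1) * (a \<bullet> y) \<le> (e - 1) * (a \<bullet> x)" by (simp add: algebra_simps)
  then have "a \<bullet> y \<le> a \<bullet> x" using e(1) by simp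
  with min[OF y] show ?thesis by simp
qed

text \<open>Moving w into \<phi> gives \<eta>, and x minimizes \<eta> + \<psi> on the intersection.
  The two summands then get separate arguments y and z, and K records the difference y - z together
  with the attainable values. The slope q of a hyperplane supporting K is the price of that
  difference and determines how w splits.\<close>

lemma subgradient_on_add_split:
  fixes \<phi> \<psi> :: "'a::euclidean_space \<Rightarrow> real"
  assumes cvx: "convex_on S \<phi>" "convex_on T \<psi>"
    and x0: "x0 \<in> rel_interior S" "x0 \<in> rel_interior T"
    and x: "x \<in> S" "x \<in> T"
    and sub: "subgradient_on (S \<inter> T) (\<lambda>y. \<phi> y + \<psi> y) x w"
  obtains u v where "subgradient_on S \<phi> x u" "subgradient_on T \<psi> x v" "u + v = w"
proof -
  have cS: "convex S" and cT: "convex T" using cvx by (auto simp: convex_on_imp_convex)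
  define \<eta> where "\<eta> y = \<phi> y + (- w) \<bullet> (y - x)" for y
  have "convex_on S (\<lambda>y. (- w) \<bullet> (y - x))"
    by (rule convex_onI) (use cS in \<open>auto simp: algebra_simps\<close>)
  then have c\<eta>: "convex_on S \<eta>" unfolding \<eta>_def by (rule convex_on_add[OF cvx(1)])
  define c where "c = \<phi> x + \<psi> x"
  define h :: "('a \<times> real) \<times> ('a \<times> real) \<Rightarrow> 'a \<times> real"
    where "h = (\<lambda>p. (fst (fst p) - fst (snd p), snd (fst p) + snd (snd p)))"
  \<comment> \<open>Minimality puts (0, c) on the relative boundary of K; a supporting hyperplane there is not
    vertical because the relative interiors of S and T meet.\<close>
  define K where "K = h ` (epigraph S \<eta> \<times> epigraph T \<psi>)"
  have "linear h" by (auto simp: linear_iff h_def algebra_simps)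
  moreover have "convex (epigraph S \<eta> \<times> epigraph T \<psi>)"
    using c\<eta> cvx(2) cS cT by (simp add: convex_Times convex_epigraph)
  ultimately have cK: "convex K" unfolding K_def by (rule convex_linear_image)
  have KI: "(y - z, r) \<in> K" if "y \<in> S" "z \<in> T" "\<eta> y + \<psi> z \<le> r" for y z r
    unfolding K_def h_def epigraph_def using that
    by (intro image_eqI[where x = "((y, r - \<psi> z), (z, \<psi> z))"]) auto
  have KE: "\<exists>y z. y \<in> S \<and> z \<in> T \<and> \<eta> y + \<psi> z \<le> snd p \<and> fst p = y - z" if "p \<in> K" for p
    using that unfolding K_def h_def epigraph_def by fastforce
  have K0: "(0, r) \<in> K" if "c \<le> r" for r
    using KI[OF x, of r] that by (simp add: \<eta>_def c_def)
  have Kmin: "c \<le> r" if "(0, r) \<in> K" for r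
    using KE[OF that] sub by (force simp: \<eta>_def c_def subgradient_on_def)
  \<comment> \<open>Otherwise the segment from (0, c + 1) could be prolonged beyond (0, c) within K,
    to a value below c over difference 0.\<close>
  have "(0, c) \<notin> rel_interior K"
  proof
    assume "(0, c) \<in> rel_interior K"
    moreover have "K \<noteq> {}" using K0[of c] by blast
    moreover have "(0, c + 1) \<in> K" by (rule K0) simp
    ultimately obtain e where e: "e > 1" "(1 - e) *\<^sub>R (0, c + 1) + e *\<^sub>R (0::'a, c) \<in> K"
      using convex_rel_interior_iff[OF cK] by blast
    then have "c \<le> (1 - e) * (c + 1) + e * c" by (intro Kmin) (simp add: prod_eq_iff)
    then show False using e(1) by (simp add: algebra_simps)
  qed
  then obtain A where "A \<noteq> 0" and A: "\<And>p. p \<in> K \<Longrightarrow> A \<bullet> (0, c) \<le> A \<bullet> p"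
    "\<And>p. p \<in> rel_interior K \<Longrightarrow> A \<bullet> (0, c) < A \<bullet> p"
    by (rule supporting_hyperplane_rel_boundary[OF cK K0[OF order_refl]]) (rule that)
  obtain a \<alpha> where Aa: "A = (a, \<alpha>)" by (cases A)
  have sep: "\<alpha> * c \<le> a \<bullet> (y - z) + \<alpha> * r" if "y \<in> S" "z \<in> T" "\<eta> y + \<psi> z \<le> r" for y z r
    using A(1)[OF KI[OF that]] by (simp add: Aa)
  have "\<alpha> \<ge> 0" using sep[OF x, of "c + 1"] by (simp add: \<eta>_def c_def algebra_simps)
  moreover have "\<alpha> \<noteq> 0"
  proof
    assume \<alpha>0: "\<alpha> = 0"
    have le: "a \<bullet> z \<le> a \<bullet> y" if "y \<in> S" "z \<in> T" for y z
      using sep[OF that, of "\<eta> y + \<psi> z"] by (simp add: \<alpha>0 inner_diff_right)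
    have x0S: "x0 \<in> S" "x0 \<in> T" using x0 rel_interior_subset by auto
    \<comment> \<open>By \<open>le\<close>, x0 minimizes the functional a over S and maximizes it
      over T, so a is constant on both sets with the same value. Then A vanishes on K, although it
      is strictly positive on the nonempty relative interior of K.\<close>
    have eq1: "a \<bullet> y = a \<bullet> x0" if "y \<in> S" for y
      using inner_const_of_min_rel_interior[OF cS x0(1) that, of a] le x0S(2) by blast
    have eq2: "a \<bullet> z = a \<bullet> x0" if "z \<in> T" for z
      using inner_const_of_min_rel_interior[OF cT x0(2) that, of "- a"] le[OF x0S(1)] by simp
    have "rel_interior K \<noteq> {}" using K0[of c] cK rel_interior_eq_empty by fastforce
    then obtain p where p: "p \<in> rel_interior K" by blast
    then obtain y z where "y \<in> S" "z \<in> T" "fst p = y - z"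
      using KE rel_interior_subset by blast
    then have "A \<bullet> p = 0" using eq1 eq2
      by (simp add: Aa \<alpha>0 inner_prod_def inner_diff_right)
    with A(2)[OF p] show False by (simp add: Aa \<alpha>0)
  qed
  ultimately have \<alpha>: "\<alpha> > 0" by simp
  define q where "q = (1 / \<alpha>) *\<^sub>R a"
  have key: "c \<le> q \<bullet> (y - z) + (\<eta> y + \<psi> z)" if "y \<in> S" "z \<in> T" for y z
  proof -
    have "\<alpha> * (q \<bullet> (y - z)) = a \<bullet> (y - z)" using \<alpha> by (simp add: q_def)
    then have "\<alpha> * c \<le> \<alpha> * (q \<bullet> (y - z) + (\<eta> y + \<psi> z))"
      using sep[OF that order_refl] by (simp add: algebra_simps)
    then show ?thesis using \<alpha> by simp
  qed
  \<comment> \<open>Fixing z = x in \<open>key\<close> leaves an inequality in y alone; fixing y = x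
    below does the same for z.\<close>
  have "subgradient_on S \<phi> x (w - q)"
    unfolding subgradient_on_def
    using key[OF _ x(2)] by (auto simp: \<eta>_def c_def algebra_simps)
  moreover have "subgradient_on T \<psi> x q"
    unfolding subgradient_on_def
    using key[OF x(1)] by (auto simp: \<eta>_def c_def algebra_simps)
  ultimately show ?thesis using that by simp
qed

text \<open>On the singleton {x} every vector, in particular 0, is a subgradient. Splitting it
  between T and {x} leaves a subgradient on T.\<close>

lemma subgradient_on_exists:
  fixes \<gamma> :: "'a::euclidean_space \<Rightarrow> real"
  assumes "convex_on T \<gamma>" "x \<in> interior T"
  obtains v where "subgradient_on T \<gamma> x v"
proof -
  have "x \<in> T" "x \<in> rel_interior T"
    using assms(2) interior_subset interior_subset_rel_interior by blast+
  moreover have "convex_on {x} (\<lambda>y. 0::real)" by (simp add: convex_on_const)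
  ultimately show ?thesis
    using subgradient_on_add_split[OF assms(1), of "{x}" "\<lambda>y. 0" x x 0] that
    by (auto simp: subgradient_on_def)
qed

text \<open>For l > 0 one divides by l. For l = 0, a step from x of length e along v stays in T and
  forces v = 0, so any subgradient of \<gamma> at x will do.\<close>

lemma subgradient_on_cmult:
  fixes \<gamma> :: "'a::euclidean_space \<Rightarrow> real"
  assumes cvx: "convex_on T \<gamma>" and x: "x \<in> interior T" and "l \<ge> 0"
    and v: "subgradient_on T (\<lambda>y. l * \<gamma> y) x v"
  obtains u where "subgradient_on T \<gamma> x u" "v = l *\<^sub>R u"
proof (cases "l = 0")
  case True
  obtain u where u: "subgradient_on T \<gamma> x u" using subgradient_on_exists[OF cvx x] .
  obtain e where e: "e > 0" "cball x e \<subseteq> T" using x by (auto simp: mem_interior_cball)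
  have "v = 0"
  proof (rule ccontr)
    assume nz: "v \<noteq> 0"
    let ?y = "x + (e / norm v) *\<^sub>R v"
    have "?y \<in> T" using e nz by (auto simp: dist_norm intro!: subsetD[OF e(2)])
    then have "(e / norm v) * (v \<bullet> v) \<le> 0"
      using v True by (fastforce simp: subgradient_on_def)
    moreover have "(e / norm v) * (v \<bullet> v) > 0" using e nz by simp
    ultimately show False by simp
  qed
  with u True show ?thesis using that by simp
next
  case False
  then have l: "l > 0" using \<open>l \<ge> 0\<close> by simp
  have "\<gamma> x + ((1 / l) *\<^sub>R v) \<bullet> (y - x) \<le> \<gamma> y" if "y \<in> T" for y
  proof -
    have "l * \<gamma> x + v \<bullet> (y - x) \<le> l * \<gamma> y" using v that by (simp add: subgradient_on_def)
    then show ?thesis using l by (simp add: field_simps)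
  qed
  then have "subgradient_on T \<gamma> x ((1 / l) *\<^sub>R v)" by (simp add: subgradient_on_def)
  then show ?thesis using that l by simp
qed

section \<open>Finitely many real-valued constraints\<close>

text \<open>Induction over the constraints, with S and \<phi> varying: the step passes to the
  objective \<open>\<phi> y + m * \<gamma> j y\<close> on \<open>S \<inter> T j\<close>, and the sum
  rule afterwards separates the two summands.\<close>

lemma lagrange_multipliers_real:
  fixes \<phi> :: "'a::euclidean_space \<Rightarrow> real" and \<gamma> :: "'i \<Rightarrow> 'a \<Rightarrow> real"
  assumes "finite I"
    and "convex_on S \<phi>" "x \<in> S" "x0 \<in> rel_interior S"
    and "\<And>i. i \<in> I \<Longrightarrow> convex_on (T i) (\<gamma> i)"
    and "\<And>i. i \<in> I \<Longrightarrow> x \<in> interior (T i)"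
    and "\<And>i. i \<in> I \<Longrightarrow> \<gamma> i x \<le> 0"
    and "\<And>i. i \<in> I \<Longrightarrow> x0 \<in> rel_interior (T i)"
    and "\<And>i. i \<in> I \<Longrightarrow> \<gamma> i x0 < 0"
    and "\<And>y. y \<in> S \<Longrightarrow> (\<And>i. i \<in> I \<Longrightarrow> y \<in> T i \<and> \<gamma> i y \<le> 0) \<Longrightarrow> \<phi> x \<le> \<phi> y"
  shows "\<exists>l v w. (\<forall>i\<in>I. l i \<ge> 0 \<and> l i * \<gamma> i x = 0 \<and> subgradient_on (T i) (\<gamma> i) x (v i))
    \<and> subgradient_on S \<phi> x w \<and> w + (\<Sum>i\<in>I. l i *\<^sub>R v i) = 0"
  using assms
proof (induction I arbitrary: S \<phi> rule: finite_induct)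
  case empty
  then have "subgradient_on S \<phi> x 0" by (simp add: subgradient_on_def)
  then show ?case by auto
next
  case (insert j I)
  note S = insert.prems(1-3)
  note c\<gamma> = insert.prems(4) and xint = insert.prems(5) and \<gamma>x = insert.prems(6)
    and x0int = insert.prems(7) and \<gamma>x0 = insert.prems(8) and min = insert.prems(9)
  \<comment> \<open>The constraints in I are hidden in the convex set U, so that
    \<open>\<gamma> j\<close> is the only explicit constraint left for
    \<open>slater_multiplier\<close>.\<close>
  define U where "U = S \<inter> T j \<inter> (\<Inter>i\<in>I. {y \<in> T i. \<gamma> i y \<le> 0})"
  have cS: "convex S" and cTj: "convex (T j)"
    using S(1) c\<gamma>[of j] by (auto simp: convex_on_imp_convex)
  have xT: "x \<in> T i" "x0 \<in> T i" if "i \<in> insert j I" for i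
    using xint[OF that] x0int[OF that] interior_subset rel_interior_subset by blast+
  have x0S: "x0 \<in> S" using S(3) rel_interior_subset by blast
  have lev: "convex {y \<in> T i. \<gamma> i y \<le> 0}" if "i \<in> I" for i
  proof (rule convexI)
    fix y z and a b :: real
    assume yz: "y \<in> {y \<in> T i. \<gamma> i y \<le> 0}" "z \<in> {y \<in> T i. \<gamma> i y \<le> 0}"
      and ab: "0 \<le> a" "0 \<le> b" "a + b = 1"
    have cvx: "convex_on (T i) (\<gamma> i)" using c\<gamma> that by auto
    then have "a *\<^sub>R y + b *\<^sub>R z \<in> T i"
      using yz ab by (auto dest!: convex_on_imp_convex intro: convexD)
    moreover have "\<gamma> i (a *\<^sub>R y + b *\<^sub>R z) \<le> a * \<gamma> i y + b * \<gamma> i z"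
      using cvx yz ab unfolding convex_on_def by auto
    moreover have "a * \<gamma> i y \<le> 0" "b * \<gamma> i z \<le> 0"
      using yz ab by (auto intro: mult_nonneg_nonpos)
    ultimately show "a *\<^sub>R y + b *\<^sub>R z \<in> {y \<in> T i. \<gamma> i y \<le> 0}" by simp
  qed
  have cU: "convex U" unfolding U_def
    by (intro convex_Int cS cTj convex_INT lev)
  have "convex_on U \<phi>" by (rule convex_on_subset[OF S(1)]) (use cU in \<open>auto simp: U_def\<close>)
  moreover have "convex_on U (\<gamma> j)"
    by (rule convex_on_subset[OF c\<gamma>[of j]]) (use cU in \<open>auto simp: U_def\<close>)
  moreover have "x \<in> U" "x0 \<in> U" "\<gamma> j x \<le> 0" "\<gamma> j x0 < 0"
    unfolding U_def using S x0S xT \<gamma>x \<gamma>x0 by (auto intro: less_imp_le)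
  moreover have "\<phi> x \<le> \<phi> y" if "y \<in> U" "\<gamma> j y \<le> 0" for y
    by (rule min) (use that in \<open>auto simp: U_def\<close>)
  ultimately obtain m where m: "m \<ge> 0" "m * \<gamma> j x = 0"
    and mmin: "\<And>y. y \<in> U \<Longrightarrow> \<phi> x \<le> \<phi> y + m * \<gamma> j y"
    using slater_multiplier[of U \<phi> "\<gamma> j" x x0] by blast
  let ?\<psi> = "\<lambda>y. \<phi> y + m * \<gamma> j y"
  have cSj: "convex (S \<inter> T j)" using cS cTj by (rule convex_Int)
  have cm: "convex_on (T j) (\<lambda>y. m * \<gamma> j y)"
    using c\<gamma>[of j] m(1) by (simp add: convex_on_cmul)
  have "convex_on (S \<inter> T j) ?\<psi>"
    by (intro convex_on_add convex_on_subset[OF S(1)] convex_on_subset[OF cm] cSj) auto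
  moreover have "x \<in> S \<inter> T j" using S(2) xT by simp
  moreover have "x0 \<in> rel_interior (S \<inter> T j)"
    using convex_rel_interior_inter_two[OF cS cTj] S(3) x0int[of j] by auto
  \<comment> \<open>By complementary slackness the new objective still has the value
    \<open>\<phi> x\<close> at x, so \<open>mmin\<close> is the minimality required by the induction
    hypothesis.\<close>
  moreover have "?\<psi> x \<le> ?\<psi> y"
    if "y \<in> S \<inter> T j" "\<And>i. i \<in> I \<Longrightarrow> y \<in> T i \<and> \<gamma> i y \<le> 0" for y
    unfolding m(2) using mmin[of y] that by (simp add: U_def)
  ultimately obtain l v w where IH:
      "\<And>i. i \<in> I \<Longrightarrow> l i \<ge> 0 \<and> l i * \<gamma> i x = 0 \<and> subgradient_on (T i) (\<gamma> i) x (v i)"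
      "subgradient_on (S \<inter> T j) ?\<psi> x w" "w + (\<Sum>i\<in>I. l i *\<^sub>R v i) = 0"
    using insert.IH[of "S \<inter> T j" ?\<psi>, OF _ _ _ c\<gamma> xint \<gamma>x x0int \<gamma>x0] by blast
  obtain u u' where u: "subgradient_on S \<phi> x u" "subgradient_on (T j) (\<lambda>y. m * \<gamma> j y) x u'"
      "u + u' = w"
    using subgradient_on_add_split[OF S(1) cm S(3) x0int[of j] S(2) xT(1)[of j] IH(2)] by auto
  obtain vj where vj: "subgradient_on (T j) (\<gamma> j) x vj" "u' = m *\<^sub>R vj"
    using subgradient_on_cmult[OF c\<gamma>[of j] xint[of j] m(1) u(2)] by auto
  have sum: "(\<Sum>i\<in>I. (l(j := m)) i *\<^sub>R (v(j := vj)) i) = (\<Sum>i\<in>I. l i *\<^sub>R v i)"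
    by (rule sum.cong) (use insert.hyps in auto)
  have "u + (\<Sum>i\<in>insert j I. (l(j := m)) i *\<^sub>R (v(j := vj)) i) = 0"
    using IH(3) insert.hyps sum unfolding u(3)[symmetric] vj(2) by (simp add: algebra_simps)
  moreover have "\<forall>i\<in>insert j I. (l(j := m)) i \<ge> 0 \<and> (l(j := m)) i * \<gamma> i x = 0
      \<and> subgradient_on (T i) (\<gamma> i) x ((v(j := vj)) i)"
    using IH(1) m vj(1) by auto
  ultimately show ?case using u(1) by blast
qed

subsection \<open>Nearly convex sets and functions\<close>

text \<open>A convex set and its closure share affine hull and relative interior, and S is squeezed
  between them.\<close>

lemma rel_interior_between_closure:
  fixes C S :: "'a::euclidean_space set"
  assumes "convex C" "C \<subseteq> S" "S \<subseteq> closure C"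
  shows "rel_interior S = rel_interior C"
proof -
  have aff: "affine hull S = affine hull C"
    using hull_mono[OF assms(2), of affine] hull_mono[OF assms(3), of affine] by auto
  have "rel_interior S \<subseteq> rel_interior (closure C)"
    using subset_rel_interior[OF assms(3)] aff by simp
  then show ?thesis
    using subset_rel_interior[OF assms(2)] aff convex_rel_interior_closure[OF assms(1)] by auto
qed

text \<open>The relative interior thus is itself a convex witness of near convexity, independent of
  the chosen C.\<close>

lemma nearly_convex_rel_interior:
  assumes "nearly_convex S"
  shows "convex (rel_interior S)" "S \<subseteq> closure (rel_interior S)"
    "rel_interior (rel_interior S) = rel_interior S"
proof -
  obtain C where C: "convex C" "C \<subseteq> S" "S \<subseteq> closure C"
    using assms unfolding nearly_convex_def by blast
  note eq = rel_interior_between_closure[OF C]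
  show "convex (rel_interior S)" "S \<subseteq> closure (rel_interior S)"
    "rel_interior (rel_interior S) = rel_interior S"
    unfolding eq using C
    by (simp_all add: convex_rel_interior convex_closure_rel_interior rel_interior_rel_interior)
qed

lemma nearly_convex_segment:
  assumes S: "nearly_convex S" and p: "p \<in> rel_interior S" and q: "q \<in> S" and t: "0 < t" "t \<le> 1"
  shows "(1 - t) *\<^sub>R q + t *\<^sub>R p \<in> rel_interior S"
  using rel_interior_closure_convex_shrink[OF nearly_convex_rel_interior(1)[OF S], of p q t]
    nearly_convex_rel_interior[OF S] p q t by (auto simp: algebra_simps)

text \<open>The point x may lie on the relative boundary. Segments from x into the relative interior
  enter it at once, so adjoining x keeps convexity, and the new set still lies within the
  closure.\<close>

lemma convex_insert_rel_interior:
  assumes S: "nearly_convex S" and x: "x \<in> S"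
  shows "convex (insert x (rel_interior S))"
    "rel_interior (insert x (rel_interior S)) = rel_interior S"
proof -
  note ri = nearly_convex_rel_interior[OF S]
  show "convex (insert x (rel_interior S))"
    unfolding convex_alt
  proof (intro ballI allI impI)
    fix y z and u :: real
    assume yz: "y \<in> insert x (rel_interior S)" "z \<in> insert x (rel_interior S)"
      and "0 \<le> u \<and> u \<le> 1"
    then consider "u = 0" | "u = 1" | "0 < u" "u < 1" by linarith
    then show "(1 - u) *\<^sub>R y + u *\<^sub>R z \<in> insert x (rel_interior S)"
    proof cases
      case 3
      have "y = x \<and> z = x \<or> z \<in> rel_interior S \<or> y \<in> rel_interior S \<and> z = x" using yz by auto
      moreover have "y \<in> S" using yz x rel_interior_subset by blast
      ultimately show ?thesis
        using nearly_convex_segment[OF S, of z y u] nearly_convex_segment[OF S, of y x "1 - u"] x 3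
        by (auto simp: scaleR_left_distrib[symmetric] add.commute)
    qed (use yz in auto)
  qed
  show "rel_interior (insert x (rel_interior S)) = rel_interior S"
    using rel_interior_between_closure[OF ri(1), of "insert x (rel_interior S)"] ri x
      closure_subset by auto
qed

section \<open>Epigraphs and effective domains\<close>

lemma eff_dom_eq_fst_epi: "eff_dom h = fst ` epi h"
proof -
  have "\<exists>r. h x \<le> ereal r" if "h x < \<infinity>" for x
    using that by (cases "h x") auto
  then show ?thesis
    by (force simp: eff_dom_def epi_def intro: le_less_trans)
qed

text \<open>The domain is the projection of the epigraph. A linear map commutes with the relative
  interior of a convex set and sends closure into closure, so the projection of a witness C is a
  witness for the domain.\<close>

lemma nearly_convex_eff_dom:
  assumes "nearly_convex_fun h"
  shows "nearly_convex (eff_dom h)" "fst ` rel_interior (epi h) = rel_interior (eff_dom h)"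
proof -
  obtain C where C: "convex C" "C \<subseteq> epi h" "epi h \<subseteq> closure C"
    using assms unfolding nearly_convex_fun_def nearly_convex_def by blast
  have D: "convex (fst ` C)" "fst ` C \<subseteq> eff_dom h" "eff_dom h \<subseteq> closure (fst ` C)"
    unfolding eff_dom_eq_fst_epi
    using C convex_linear_image[OF linear_fst] closure_linear_image_subset[OF linear_fst, of C]
    by blast+
  then show "nearly_convex (eff_dom h)" unfolding nearly_convex_def by blast
  show "fst ` rel_interior (epi h) = rel_interior (eff_dom h)"
    using rel_interior_convex_linear_image[OF linear_fst C(1)]
      rel_interior_between_closure[OF C] rel_interior_between_closure[OF D] by simp
qed

lemma proper_fun_finite:
  assumes "proper_fun h" "y \<in> eff_dom h"
  shows "ereal (real_of_ereal (h y)) = h y" "\<bar>h y\<bar> \<noteq> \<infinity>"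
  using assms unfolding proper_fun_def eff_dom_def by (cases "h y"; force)+

text \<open>Projection yields some height b with (y, b) relatively interior; the segment principle
  on the vertical line through y carries this to the height r.\<close>

lemma mem_rel_interior_epi:
  assumes h: "nearly_convex_fun h" and y: "y \<in> rel_interior (eff_dom h)" and r: "h y < ereal r"
  shows "(y, r) \<in> rel_interior (epi h)"
proof -
  have E: "nearly_convex (epi h)" using h by (simp add: nearly_convex_fun_def)
  obtain b where b: "(y, b) \<in> rel_interior (epi h)"
    using y nearly_convex_eff_dom(2)[OF h] by force
  \<comment> \<open>The height a belongs to the epigraph and lies on the other side of r from b. For
    r < b this needs room strictly between \<open>h y\<close> and r. As r differs from a, the weight
    t of b below is positive.\<close>
  obtain a where a: "a \<noteq> b" "(a < r \<and> r < b) \<or> (b \<le> r \<and> r < a)" "h y \<le> ereal a"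
  proof (cases "r < b")
    case True
    obtain a where "h y < ereal a" "ereal a < ereal r" using ereal_dense2[OF r] by blast
    then show ?thesis using that[of a] True by auto
  next
    case False
    have "h y \<le> ereal (r + 1)" using r by (metis ereal_less_eq(3) less_add_one less_imp_le order_trans)
    then show ?thesis using that[of "r + 1"] False by auto
  qed
  define t where "t = (r - a) / (b - a)"
  have t: "0 < t" "t \<le> 1" using a by (auto simp: t_def field_simps)
  have "t * (b - a) = r - a" using a(1) by (simp add: t_def)
  then have "(1 - t) *\<^sub>R (y, a) + t *\<^sub>R (y, b) = (y, r)"
    by (simp add: algebra_simps)
  then show ?thesis
    using nearly_convex_segment[OF E b _ t, of "(y, a)"] a(3) by (simp add: epi_def)
qed

section \<open>Passage between extended-valued and real-valued functions\<close>

lemma convex_on_insert_rel_interior: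
  assumes h: "proper_fun h" "nearly_convex_fun h" and x: "x \<in> eff_dom h"
  shows "convex_on (insert x (rel_interior (eff_dom h))) (\<lambda>y. real_of_ereal (h y))"
    (is "convex_on ?S ?h")
proof -
  note dom = nearly_convex_eff_dom(1)[OF h(2)]
  have E: "nearly_convex (epi h)" using h by (simp add: nearly_convex_fun_def)
  have cS: "convex ?S" by (rule convex_insert_rel_interior[OF dom x])
  have fin: "ereal (?h y) = h y" if "y \<in> ?S" for y
    using proper_fun_finite[OF h(1)] that x rel_interior_subset by blast
  \<comment> \<open>One relatively interior endpoint y suffices. Raising its height by e puts it in
    the relative interior of the epigraph, so the segment to the graph point over z stays in the
    epigraph; e is arbitrary.\<close>
  have half: "?h ((1 - t) *\<^sub>R z + t *\<^sub>R y) \<le> (1 - t) * ?h z + t * ?h y"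
    if y: "y \<in> rel_interior (eff_dom h)" and z: "z \<in> ?S" and t: "0 < t" "t \<le> 1" for y z t
  proof (rule field_le_epsilon)
    fix e :: real assume e: "e > 0"
    have "h y < ereal (?h y + e)" using fin[of y] y e by (metis insertCI less_add_same_cancel1 less_ereal.simps(1))
    then have "(y, ?h y + e) \<in> rel_interior (epi h)" using mem_rel_interior_epi h y by blast
    moreover have "(z, ?h z) \<in> epi h" using fin[OF z] by (simp add: epi_def)
    ultimately have "(1 - t) *\<^sub>R (z, ?h z) + t *\<^sub>R (y, ?h y + e) \<in> epi h"
      using nearly_convex_segment[OF E _ _ t] rel_interior_subset by blast
    then have "h ((1 - t) *\<^sub>R z + t *\<^sub>R y) \<le> ereal ((1 - t) * ?h z + t * (?h y + e))"
      by (simp add: epi_def)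
    moreover have "(1 - t) *\<^sub>R z + t *\<^sub>R y \<in> ?S"
      using cS y z t by (intro convexD) auto
    ultimately have "?h ((1 - t) *\<^sub>R z + t *\<^sub>R y) \<le> (1 - t) * ?h z + t * (?h y + e)"
      using fin by (metis ereal_less_eq(3))
    moreover have "t * e \<le> 1 * e" using t e by (intro mult_right_mono) auto
    ultimately show "?h ((1 - t) *\<^sub>R z + t *\<^sub>R y) \<le> (1 - t) * ?h z + t * ?h y + e"
      by (simp add: algebra_simps)
  qed
  show ?thesis
  proof (rule convex_onI[OF _ cS])
    fix t :: real and y z assume t: "0 < t" "t < 1" and yz: "y \<in> ?S" "z \<in> ?S"
    consider "z \<in> rel_interior (eff_dom h)" | "y \<in> rel_interior (eff_dom h)" | "y = x" "z = x"
      using yz by blast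
    then show "?h ((1 - t) *\<^sub>R y + t *\<^sub>R z) \<le> (1 - t) * ?h y + t * ?h z"
    proof cases
      case 1
      then show ?thesis using half[of z y t] yz t by simp
    next
      case 2
      then show ?thesis using half[of y z "1 - t"] yz t by (simp add: add.commute)
    next
      case 3
      then show ?thesis by (simp add: scaleR_left_distrib[symmetric] algebra_simps)
    qed
  qed
qed

text \<open>The hypothesis places the relative interior of the epigraph in the closed half-space
  \<open>?H\<close>. Closedness extends this to the whole epigraph, and outside the domain h is
  infinite.\<close>

lemma subdifferential_of_subgradient_on:
  assumes h: "proper_fun h" "nearly_convex_fun h" and x: "x \<in> eff_dom h"
    and v: "subgradient_on (insert x (rel_interior (eff_dom h))) (\<lambda>y. real_of_ereal (h y)) x v"
  shows "v \<in> subdifferential h x"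
proof -
  have E: "nearly_convex (epi h)" using h by (simp add: nearly_convex_fun_def)
  define c where "c = real_of_ereal (h x)"
  have hx: "h x = ereal c" using proper_fun_finite[OF h(1) x] by (simp add: c_def)
  let ?H = "{p::'a \<times> real. c + v \<bullet> (fst p - x) \<le> snd p}"
  have "rel_interior (epi h) \<subseteq> ?H"
  proof
    fix p assume p: "p \<in> rel_interior (epi h)"
    then have y: "fst p \<in> rel_interior (eff_dom h)"
      using nearly_convex_eff_dom(2)[OF h(2)] by blast
    have "h (fst p) \<le> ereal (snd p)" using p rel_interior_subset by (force simp: epi_def)
    moreover have "ereal (real_of_ereal (h (fst p))) = h (fst p)"
      using proper_fun_finite(1)[OF h(1)] y rel_interior_subset by blast
    ultimately have "real_of_ereal (h (fst p)) \<le> snd p" by (metis ereal_less_eq(3))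
    then show "p \<in> ?H" using v y by (force simp: subgradient_on_def c_def)
  qed
  moreover have "closed ?H" by (intro closed_Collect_le continuous_intros)
  ultimately have H: "epi h \<subseteq> ?H"
    using nearly_convex_rel_interior(2)[OF E] closure_minimal by blast
  have "ereal (v \<bullet> (y - x)) \<le> h y - h x" for y
  proof (cases "y \<in> eff_dom h")
    case True
    then obtain d where d: "h y = ereal d" using proper_fun_finite(1)[OF h(1)] by metis
    then have "(y, d) \<in> ?H" by (intro subsetD[OF H]) (simp add: epi_def)
    with d show ?thesis by (simp add: hx)
  next
    case False
    then have "h y = \<infinity>" by (simp add: eff_dom_def)
    then show ?thesis by (simp add: hx)
  qed
  then show ?thesis by (simp add: subdifferential_def hx)
qed

text \<open>The domain of the closure of h lies in the closure of the convex set
  \<open>rel_interior (eff_dom h)\<close>, and a convex set has the same interior as its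
  closure.\<close>

lemma interior_rel_interior_eff_dom:
  assumes h: "nearly_convex_fun h" and cont: "continuous_at_pt (closure_fun h) x"
  shows "x \<in> interior (rel_interior (eff_dom h))"
proof -
  note dom = nearly_convex_rel_interior[OF nearly_convex_eff_dom(1)[OF h]]
  have "eff_dom (closure_fun h) \<subseteq> closure (eff_dom h)"
  proof
    fix y assume "y \<in> eff_dom (closure_fun h)"
    \<comment> \<open>An infimum below infinity is taken over a nonempty set, which yields a point
      of the closed epigraph over y.\<close>
    then have "(INF r\<in>{r. (y, r) \<in> closure (epi h)}. ereal r) < \<infinity>"
      by (simp add: eff_dom_def closure_fun_def del: ereal_infty_less)
    then obtain r where "(y, r) \<in> closure (epi h)"
      unfolding INF_less_iff by blast
    then show "y \<in> closure (eff_dom h)"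
      unfolding eff_dom_eq_fst_epi
      using closure_linear_image_subset[OF linear_fst, of "epi h"] by force
  qed
  also have "\<dots> \<subseteq> closure (rel_interior (eff_dom h))"
    using dom(2) by (simp add: closure_minimal)
  finally show ?thesis
    using cont interior_mono unfolding continuous_at_pt_def convex_interior_closure[OF dom(1), symmetric]
    by blast
qed

subsection \<open>Lagrange conditions\<close>

text \<open>Membership in the Minkowski sum becomes a choice of one subgradient per index, demanded
  also where the multiplier is 0.\<close>

lemma lagrange_conditions_iff:
  "lagrange_conditions f \<Omega> m g x l \<longleftrightarrow>
    (\<exists>u v n. u \<in> subdifferential f x \<and> (\<forall>i\<in>{1..m}. v i \<in> subdifferential (g i) x)
      \<and> n \<in> normal_cone x \<Omega> \<and> u + (\<Sum>i=1..m. l i *\<^sub>R v i) + n = 0)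
    \<and> (\<forall>i\<in>{1..m}. ereal (l i) * g i x = 0)" (is "_ \<longleftrightarrow> ?R \<and> ?C")
proof -
  let ?P = "0 \<in> subdifferential f x + (\<Sum>i=1..m. (\<lambda>v. l i *\<^sub>R v) ` subdifferential (g i) x)
    + normal_cone x \<Omega>"
  have "?P = ?R"
  proof
    assume ?P
    then obtain u s n where un: "u \<in> subdifferential f x" "n \<in> normal_cone x \<Omega>" "0 = u + s + n"
      and "s \<in> (\<Sum>i=1..m. (\<lambda>v. l i *\<^sub>R v) ` subdifferential (g i) x)"
      by (elim set_plus_elim) blast
    then obtain t where t: "s = sum t {1..m}"
      "\<And>i. i \<in> {1..m} \<Longrightarrow> t i \<in> (\<lambda>v. l i *\<^sub>R v) ` subdifferential (g i) x"
      by (auto simp: set_sum_alt)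
    then have "\<forall>i\<in>{1..m}. \<exists>v. v \<in> subdifferential (g i) x \<and> t i = l i *\<^sub>R v" by blast
    then obtain v where v: "\<And>i. i \<in> {1..m} \<Longrightarrow> v i \<in> subdifferential (g i) x \<and> t i = l i *\<^sub>R v i"
      by metis
    have "s = (\<Sum>i=1..m. l i *\<^sub>R v i)" unfolding t(1) by (rule sum.cong) (use v in auto)
    then show ?R using un v by metis
  next
    assume ?R
    then obtain u v n where *: "u \<in> subdifferential f x" "n \<in> normal_cone x \<Omega>"
      "\<And>i. i \<in> {1..m} \<Longrightarrow> v i \<in> subdifferential (g i) x" "u + (\<Sum>i=1..m. l i *\<^sub>R v i) + n = 0"
      by blast
    have "(\<Sum>i=1..m. l i *\<^sub>R v i) \<in> (\<Sum>i=1..m. (\<lambda>v. l i *\<^sub>R v) ` subdifferential (g i) x)"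
      unfolding set_sum_alt[OF finite_atLeastAtMost] using *(3) by blast
    with * show ?P by (metis set_plus_intro)
  qed
  then show ?thesis unfolding lagrange_conditions_def by simp
qed

text \<open>Pairing the vanishing sum with y - x, the constraint terms and the normal term are
  nonpositive, so the subgradient of f has a nonnegative product with y - x.\<close>

lemma lagrange_conditions_sufficient:
  fixes f :: "'a::euclidean_space \<Rightarrow> ereal" and g :: "nat \<Rightarrow> 'a \<Rightarrow> ereal"
  assumes nonneg: "\<And>i. i \<in> {1..m} \<Longrightarrow> l i \<ge> 0"
    and lag: "lagrange_conditions f \<Omega> m g x l"
    and y: "y \<in> \<Omega>" "\<And>i. i \<in> {1..m} \<Longrightarrow> g i y \<le> 0"
  shows "f x \<le> f y"
proof -
  obtain u v n where u: "u \<in> subdifferential f x"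
    and v: "\<And>i. i \<in> {1..m} \<Longrightarrow> v i \<in> subdifferential (g i) x"
    and n: "n \<in> normal_cone x \<Omega>" and sum0: "u + (\<Sum>i=1..m. l i *\<^sub>R v i) + n = 0"
    and cs: "\<And>i. i \<in> {1..m} \<Longrightarrow> ereal (l i) * g i x = 0"
    using lag unfolding lagrange_conditions_iff by blast
  have "(l i *\<^sub>R v i) \<bullet> (y - x) \<le> 0" if i: "i \<in> {1..m}" for i
  proof -
    have "\<bar>g i x\<bar> \<noteq> \<infinity>" and sub: "ereal (v i \<bullet> (y - x)) \<le> g i y - g i x"
      using v[OF i] by (auto simp: subdifferential_def split: if_splits)
    then obtain a where a: "g i x = ereal a" by auto
    \<comment> \<open>Feasibility of y bounds the product by \<open>- g i x\<close>; multiplication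
      by \<open>l i\<close> turns this bound into 0 by complementary slackness.\<close>
    have "v i \<bullet> (y - x) \<le> - a" using sub y(2)[OF i] a by (cases "g i y") auto
    then have "l i * (v i \<bullet> (y - x)) \<le> l i * (- a)" using nonneg[OF i] by (rule mult_left_mono)
    also have "\<dots> = 0" using cs[OF i] a by simp
    finally show ?thesis by simp
  qed
  then have "(\<Sum>i=1..m. l i *\<^sub>R v i) \<bullet> (y - x) \<le> 0"
    unfolding inner_sum_left by (rule sum_nonpos)
  moreover have "n \<bullet> (y - x) \<le> 0" using n y(1) by (simp add: normal_cone_def)
  moreover have "u \<bullet> (y - x) + (\<Sum>i=1..m. l i *\<^sub>R v i) \<bullet> (y - x) + n \<bullet> (y - x) = 0"
    unfolding inner_add_left[symmetric] sum0 by simp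
  ultimately have "0 \<le> ereal (u \<bullet> (y - x))" by simp
  moreover have "\<bar>f x\<bar> \<noteq> \<infinity>" "ereal (u \<bullet> (y - x)) \<le> f y - f x"
    using u by (auto simp: subdifferential_def split: if_splits)
  ultimately show ?thesis
    by (metis ereal_minus_le_iff ereal_le_minus add_0 add.commute order_trans)
qed

text \<open>The real-valued lemma is applied on \<open>F \<inter> W\<close>, built from relative
  interiors with x adjoined. The resulting vectors are then carried back to f, the
  \<open>g i\<close> and \<Omega>.\<close>

lemma lagrange_conditions_necessary:
  fixes f :: "'a::euclidean_space \<Rightarrow> ereal" and g :: "nat \<Rightarrow> 'a \<Rightarrow> ereal"
  assumes f: "proper_fun f" "nearly_convex_fun f"
    and \<Omega>: "nearly_convex \<Omega>"
    and g: "\<And>i. i \<in> {1..m} \<Longrightarrow> proper_fun (g i)" "\<And>i. i \<in> {1..m} \<Longrightarrow> nearly_convex_fun (g i)"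
    and x0: "x0 \<in> rel_interior \<Omega>" "x0 \<in> rel_interior (eff_dom f)"
      "\<And>i. i \<in> {1..m} \<Longrightarrow> x0 \<in> rel_interior (eff_dom (g i))"
    and slater: "\<And>i. i \<in> {1..m} \<Longrightarrow> g i x0 < 0"
    and x: "x \<in> \<Omega>" "x \<in> eff_dom f" "\<And>i. i \<in> {1..m} \<Longrightarrow> g i x \<le> 0"
    and cont: "\<And>i. i \<in> {1..m} \<Longrightarrow> continuous_at_pt (closure_fun (g i)) x"
    and min: "\<And>y. y \<in> \<Omega> \<Longrightarrow> (\<And>i. i \<in> {1..m} \<Longrightarrow> g i y \<le> 0) \<Longrightarrow> f x \<le> f y"
  obtains l where "\<And>i. i \<in> {1..m} \<Longrightarrow> l i \<ge> 0" "lagrange_conditions f \<Omega> m g x l"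
proof -
  define \<phi> where "\<phi> y = real_of_ereal (f y)" for y
  define \<gamma> where "\<gamma> i y = real_of_ereal (g i y)" for i y
  define F where "F = insert x (rel_interior (eff_dom f))"
  define W where "W = insert x (rel_interior \<Omega>)"
  define T where "T i = insert x (rel_interior (eff_dom (g i)))" for i
  have F: "convex_on F \<phi>" "rel_interior F = rel_interior (eff_dom f)"
    unfolding F_def \<phi>_def
    using convex_on_insert_rel_interior[OF f x(2)]
      convex_insert_rel_interior(2)[OF nearly_convex_eff_dom(1)[OF f(2)] x(2)] by auto
  have W: "convex W" "rel_interior W = rel_interior \<Omega>"
    unfolding W_def using convex_insert_rel_interior[OF \<Omega> x(1)] by auto
  have xg: "x \<in> eff_dom (g i)" if "i \<in> {1..m}" for i
    using le_less_trans[OF x(3)[OF that], of \<infinity>] by (simp add: eff_dom_def)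
  have T: "convex_on (T i) (\<gamma> i)" "rel_interior (T i) = rel_interior (eff_dom (g i))"
    "x \<in> interior (T i)" if i: "i \<in> {1..m}" for i
    unfolding T_def \<gamma>_def
    using convex_on_insert_rel_interior[OF g(1)[OF i] g(2)[OF i] xg[OF i]]
      convex_insert_rel_interior(2)[OF nearly_convex_eff_dom(1)[OF g(2)[OF i]] xg[OF i]]
      interior_rel_interior_eff_dom[OF g(2)[OF i] cont[OF i]] interior_mono[OF subset_insertI]
    by auto
  have f\<phi>: "f y = ereal (\<phi> y)" if "y \<in> F" for y
    using proper_fun_finite(1)[OF f(1), of y] that x(2) rel_interior_subset
    unfolding F_def \<phi>_def by (metis insert_iff subsetD)
  have g\<gamma>: "g i y = ereal (\<gamma> i y)" if "i \<in> {1..m}" "y \<in> T i" for i y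
    using proper_fun_finite(1)[OF g(1)[OF that(1)], of y] that(2) xg[OF that(1)] rel_interior_subset
    unfolding T_def \<gamma>_def by (metis insert_iff subsetD)
  have cF: "convex F" using F(1) by (rule convex_on_imp_convex)
  have cFW: "convex (F \<inter> W)" using cF W(1) by (rule convex_Int)
  have "convex_on (F \<inter> W) \<phi>" by (rule convex_on_subset[OF F(1) _ cFW]) simp
  moreover have "x \<in> F \<inter> W" by (simp add: F_def W_def)
  moreover have "x0 \<in> rel_interior (F \<inter> W)"
    using convex_rel_interior_inter_two[OF cF W(1)] F(2) W(2) x0 by auto
  moreover have "x0 \<in> rel_interior (T i)" if "i \<in> {1..m}" for i
    using T(2)[OF that] x0(3)[OF that] by simp
  moreover have "\<gamma> i x \<le> 0" if "i \<in> {1..m}" for i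
    using x(3)[OF that] g\<gamma>[OF that, of x] by (simp add: T_def)
  moreover have "\<gamma> i x0 < 0" if "i \<in> {1..m}" for i
    using slater[OF that] g\<gamma>[OF that, of x0] x0(3)[OF that] by (simp add: T_def)
  \<comment> \<open>Points feasible for the shrunken problem are feasible for the original one, so x
    remains a minimizer.\<close>
  moreover have "\<phi> x \<le> \<phi> y"
    if y: "y \<in> F \<inter> W" "\<And>i. i \<in> {1..m} \<Longrightarrow> y \<in> T i \<and> \<gamma> i y \<le> 0" for y
  proof -
    have "y \<in> \<Omega>" using y(1) x(1) rel_interior_subset by (auto simp: W_def)
    moreover have "g i y \<le> 0" if "i \<in> {1..m}" for i using y(2)[OF that] g\<gamma>[OF that, of y] by simp
    ultimately have "f x \<le> f y" by (rule min)
    then show ?thesis using f\<phi>[of x] f\<phi>[of y] y(1) by (simp add: F_def)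
  qed
  ultimately obtain l v w where
      l: "\<And>i. i \<in> {1..m} \<Longrightarrow> l i \<ge> 0 \<and> l i * \<gamma> i x = 0 \<and> subgradient_on (T i) (\<gamma> i) x (v i)"
    and w: "subgradient_on (F \<inter> W) \<phi> x w" "w + (\<Sum>i\<in>{1..m}. l i *\<^sub>R v i) = 0"
    using lagrange_multipliers_real[of "{1..m}" "F \<inter> W" \<phi> x x0 T \<gamma>] T(1,3) by blast
  \<comment> \<open>The zero function on W acts as an indicator: the sum rule separates a normal
    vector n from the subgradient u.\<close>
  have "convex_on W (\<lambda>y. 0::real)" using W(1) by (simp add: convex_on_const)
  then obtain u n where u: "subgradient_on F \<phi> x u" and n: "subgradient_on W (\<lambda>y. 0) x n"
    and un: "u + n = w"
    using subgradient_on_add_split[OF F(1), of W "\<lambda>y. 0" x0 x w] w(1) x0 F(2) W(2)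
    by (auto simp: F_def W_def)
  have "u \<in> subdifferential f x"
    using subdifferential_of_subgradient_on[OF f x(2)] u unfolding F_def \<phi>_def by blast
  moreover have "v i \<in> subdifferential (g i) x" if i: "i \<in> {1..m}" for i
    using subdifferential_of_subgradient_on[OF g(1)[OF i] g(2)[OF i] xg[OF i]] l[OF i]
    unfolding T_def \<gamma>_def by blast
  \<comment> \<open>The half-space is closed, so the inequality passes from the relative interior to
    all of \<Omega>.\<close>
  moreover have "n \<in> normal_cone x \<Omega>"
  proof -
    have "rel_interior \<Omega> \<subseteq> {y. n \<bullet> (y - x) \<le> 0}"
      using n by (auto simp: subgradient_on_def W_def)
    moreover have "closed {y. n \<bullet> (y - x) \<le> 0}" by (intro closed_Collect_le continuous_intros)
    ultimately show ?thesis
      using nearly_convex_rel_interior(2)[OF \<Omega>] closure_minimal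
      unfolding normal_cone_def by blast
  qed
  moreover have "u + (\<Sum>i=1..m. l i *\<^sub>R v i) + n = 0" using w(2) unfolding un[symmetric] by (simp add: algebra_simps)
  moreover have "ereal (l i) * g i x = 0" if i: "i \<in> {1..m}" for i
    using l[OF i] g\<gamma>[OF i, of x] by (simp add: T_def)
  ultimately have "lagrange_conditions f \<Omega> m g x l" unfolding lagrange_conditions_iff by blast
  with l show ?thesis using that by blast
qed

theorem theorem4p4:
  fixes f :: "real ^ 'n \<Rightarrow> ereal"
    and \<Omega>\<^sub>0 \<Omega>\<^sub>1 D :: "(real ^ 'n) set"
    and m :: nat
    and g :: "nat \<Rightarrow> real ^ 'n \<Rightarrow> ereal"
    and x0 xbar :: "real ^ 'n"
  assumes "proper_fun f" and "nearly_convex_fun f"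
    and "\<Omega>\<^sub>0 \<noteq> {}" and "nearly_convex \<Omega>\<^sub>0"
    and "\<And>i. i \<in> {1..m} \<Longrightarrow> proper_fun (g i)"
    and "\<And>i. i \<in> {1..m} \<Longrightarrow> nearly_convex_fun (g i)"
    and "\<Omega>\<^sub>1 = {x. \<forall>i\<in>{1..m}. g i x \<le> 0}"
    and "D = \<Omega>\<^sub>0 \<inter> \<Omega>\<^sub>1"
    and "x0 \<in> rel_interior \<Omega>\<^sub>0 \<inter> (\<Inter>i\<in>{1..m}. rel_interior (eff_dom (g i)))"
    and "\<And>i. i \<in> {1..m} \<Longrightarrow> g i x0 < 0"
    and "x0 \<in> rel_interior (eff_dom f)"
    and "xbar \<in> D \<inter> eff_dom f"
    and "\<And>i. i \<in> {1..m} \<Longrightarrow> continuous_at_pt (closure_fun (g i)) xbar"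
    and "closure_fun f xbar = f xbar"
    and "\<And>i. i \<in> {1..m} \<Longrightarrow> closure_fun (g i) xbar = g i xbar"
  shows "(is_solution f D xbar \<longrightarrow>
            (\<exists>lam. (\<forall>i\<in>{1..m}. lam i \<ge> 0) \<and> lagrange_conditions f \<Omega>\<^sub>0 m g xbar lam))
       \<and> (xbar \<in> rel_interior (eff_dom f) \<and>
            (\<exists>lam. (\<forall>i\<in>{1..m}. lam i \<ge> 0) \<and> lagrange_conditions f \<Omega>\<^sub>0 m g xbar lam)
          \<longrightarrow> is_solution f D xbar)"
proof (intro conjI impI)
  have xbar: "xbar \<in> \<Omega>\<^sub>0" "xbar \<in> eff_dom f" "\<And>i. i \<in> {1..m} \<Longrightarrow> g i xbar \<le> 0" "xbar \<in> D"
    using assms(7,8,12) by auto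
  have mem: "y \<in> D \<longleftrightarrow> y \<in> \<Omega>\<^sub>0 \<and> (\<forall>i\<in>{1..m}. g i y \<le> 0)" for y
    using assms(7,8) by simp
  {
    assume sol: "is_solution f D xbar"
    have x0: "x0 \<in> rel_interior \<Omega>\<^sub>0" "\<And>i. i \<in> {1..m} \<Longrightarrow> x0 \<in> rel_interior (eff_dom (g i))"
      using assms(9) by auto
    have min: "f xbar \<le> f y" if "y \<in> \<Omega>\<^sub>0" "\<And>i. i \<in> {1..m} \<Longrightarrow> g i y \<le> 0" for y
      using sol that mem unfolding is_solution_def by blast
    show "\<exists>lam. (\<forall>i\<in>{1..m}. lam i \<ge> 0) \<and> lagrange_conditions f \<Omega>\<^sub>0 m g xbar lam"
      by (rule lagrange_conditions_necessary[OF assms(1,2,4,5,6) x0(1) assms(11) x0(2) assms(10)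
            xbar(1-3) assms(13) min]) blast+
  next
    assume "xbar \<in> rel_interior (eff_dom f) \<and>
      (\<exists>lam. (\<forall>i\<in>{1..m}. lam i \<ge> 0) \<and> lagrange_conditions f \<Omega>\<^sub>0 m g xbar lam)"
    then obtain lam where lam: "\<And>i. i \<in> {1..m} \<Longrightarrow> lam i \<ge> 0"
      "lagrange_conditions f \<Omega>\<^sub>0 m g xbar lam" by blast
    then show "is_solution f D xbar"
      unfolding is_solution_def using xbar(4) mem lagrange_conditions_sufficient[OF lam] by blast
  }
qed

end
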